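(* For every $n\ge 2$, the zig-zag poset $Z_n$ has an order polynomial $\Omega(Z_n;t)$ with nonnegative coefficients. In particular, the order polytope $\mathscr{O}(Z_n)$ is Ehrhart positive.
   Context: The zig-zag poset $Z_n$ is the poset on $x_1,\dots,x_n$ whose covering relations are $x_1\succ x_2\prec x_3\succ x_4\prec\cdots$ (alternating, ending at $x_n$). For a finite poset $P$, the order polynomial $\Omega(P;t)$ is the unique polynomial in $\mathbb{Q}[t]$ such that for every positive integer $t$, $\Omega(P;t)$ equals the number of maps $f:P\to\{1,\dots,t\}$ with $f(x)\le f(y)$ whenever $x\preceq y$. The order polytope of $P$ is $\mathscr{O}(P)=\{f\in[0,1]^P: f(u)\le f(v)\text{ for all }u\preceq v\text{ in }P\}$, a lattice polytope. The Ehrhart polynomial of a lattice polytope $\mathscr{P}\subseteq\mathbb{R}^n$ is the unique polynomial $\mathrm{ehr}(\mathscr{P},t)\in\mathbb{Q}[t]$ with $\mathrm{ehr}(\mathscr{P},t)=\#(t\mathscr{P}\cap\mathbb{Z}^n)$ for all positive integers $t$; $\mathscr{P}$ is Ehrhart positive if all coefficients of $\mathrm{ehr}(\mathscr{P},t)$ are nonnegative. *)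

theory Defs
  imports "HOL-Analysis.Analysis" "HOL-Computational_Algebra.Polynomial"
begin

text \<open>
  A finite poset is a relation \<open>r\<close> with \<^term>\<open>partial_order_on UNIV r\<close> on a finite type \<open>'a\<close>;
  \<open>(u, v) \<in> r\<close> means that \<open>u\<close> lies below or equals \<open>v\<close>.  Accordingly the Euclidean space
  indexed by the elements of the poset is \<open>real ^ 'a\<close>.
\<close>

definition order_preserving_maps :: "('a::finite) rel \<Rightarrow> nat \<Rightarrow> ('a \<Rightarrow> nat) set" where
  "order_preserving_maps r t =
     {f. (\<forall>u. f u \<in> {1..t}) \<and> (\<forall>(u, v) \<in> r. f u \<le> f v)}"

definition order_polynomial :: "('a::finite) rel \<Rightarrow> rat poly" where
  "order_polynomial r =
     (THE p. \<forall>t::nat. t > 0 \<longrightarrow> poly p (of_nat t) = of_nat (card (order_preserving_maps r t)))"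

definition order_polytope :: "('a::finite) rel \<Rightarrow> (real ^ 'a) set" where
  "order_polytope r =
     {f. (\<forall>u. 0 \<le> f $ u \<and> f $ u \<le> 1) \<and> (\<forall>(u, v) \<in> r. f $ u \<le> f $ v)}"

definition integer_points :: "(real ^ 'a) set" where
  "integer_points = {v. \<forall>i. v $ i \<in> \<int>}"

definition lattice_polytope :: "(real ^ 'a::finite) set \<Rightarrow> bool" where
  "lattice_polytope P \<longleftrightarrow> (\<exists>V. finite V \<and> V \<subseteq> integer_points \<and> P = convex hull V)"

definition ehrhart_polynomial :: "(real ^ 'a::finite) set \<Rightarrow> rat poly" where
  "ehrhart_polynomial P =
     (THE p. \<forall>t::nat. t > 0 \<longrightarrow>
        poly p (of_nat t) = of_nat (card ((\<lambda>v. real t *\<^sub>R v) ` P \<inter> integer_points)))"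

definition ehrhart_positive :: "(real ^ 'a::finite) set \<Rightarrow> bool" where
  "ehrhart_positive P \<longleftrightarrow>
     lattice_polytope P \<and> (\<forall>k. coeff (ehrhart_polynomial P) k \<ge> 0)"

text \<open>
  The elements of the zig-zag poset are \<open>x 1, \<dots>, x n\<close>, assumed distinct where it is used.  Since
  \<open>x 1\<close> is above \<open>x 2\<close>, the elements with odd index are the maximal ones.
\<close>

definition zigzag_covers :: "nat \<Rightarrow> (nat \<Rightarrow> 'a) \<Rightarrow> 'a rel" where
  "zigzag_covers n x =
     {(x (i + 1), x i) | i. odd i \<and> 1 \<le> i \<and> i + 1 \<le> n} \<union>
     {(x i, x (i + 1)) | i. even i \<and> 1 \<le> i \<and> i + 1 \<le> n}"

definition zigzag :: "nat \<Rightarrow> (nat \<Rightarrow> 'a) \<Rightarrow> 'a rel" where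
  "zigzag n x = (zigzag_covers n x)\<^sup>*"


subsection \<open>The zig-zag poset is a poset with the prescribed covering relations\<close>

lemma zigzag_covers_parity:
  assumes "(u, v) \<in> zigzag_covers n x"
  obtains i j where "u = x i" "v = x j" "even i" "odd j" "i \<in> {1..n}" "j \<in> {1..n}"
proof -
  from assms consider i where "u = x (i+1)" "v = x i" "odd i" "1 \<le> i" "i + 1 \<le> n"
    | i where "u = x i" "v = x (i+1)" "even i" "1 \<le> i" "i + 1 \<le> n"
    unfolding zigzag_covers_def by blast
  then show thesis
  proof cases
    case 1 then show thesis by (intro that[of "i+1" i]) auto
  next
    case 2 then show thesis by (intro that[of i "i+1"]) auto
  qed
qed

lemma zigzag_covers_no_chain:
  assumes "inj_on x {1..n}" "(u, v) \<in> zigzag_covers n x" "(v, w) \<in> zigzag_covers n x"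
  shows False
proof -
  obtain i j where ij: "u = x i" "v = x j" "even i" "odd j" "i \<in> {1..n}" "j \<in> {1..n}"
    using zigzag_covers_parity[OF assms(2)] .
  obtain k l where kl: "v = x k" "w = x l" "even k" "odd l" "k \<in> {1..n}" "l \<in> {1..n}"
    using zigzag_covers_parity[OF assms(3)] .
  have "j = k" using inj_onD[OF assms(1)] ij kl by metis
  then show False using ij kl by simp
qed

lemma zigzag_eq:
  assumes "inj_on x {1..n}"
  shows "zigzag n x = Id \<union> zigzag_covers n x"
proof
  show "zigzag n x \<subseteq> Id \<union> zigzag_covers n x"
  proof
    fix p assume "p \<in> zigzag n x"
    then obtain u v where p: "p = (u, v)" and uv: "(u, v) \<in> (zigzag_covers n x)\<^sup>*"
      by (cases p) (auto simp: zigzag_def)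
    from uv have "(u, v) \<in> Id \<union> zigzag_covers n x"
      by (induction rule: rtrancl_induct) (use zigzag_covers_no_chain[OF assms] in auto)
    then show "p \<in> Id \<union> zigzag_covers n x" using p by simp
  qed
qed (auto simp: zigzag_def)

lemma partial_order_on_zigzag:
  assumes "bij_betw x {1..n} UNIV"
  shows "partial_order_on UNIV (zigzag n x)"
proof -
  have inj: "inj_on x {1..n}" using assms by (rule bij_betw_imp_inj_on)
  have "antisym (zigzag n x)"
    unfolding zigzag_eq[OF inj] antisym_def using zigzag_covers_no_chain[OF inj] by blast
  then show ?thesis
    by (simp add: partial_order_on_def preorder_on_def zigzag_def refl_rtrancl trans_rtrancl)
qed

lemma zigzag_covering_relations:
  assumes "bij_betw x {1..n} UNIV"
  shows "{(u, v). (u, v) \<in> zigzag n x \<and> u \<noteq> v \<and>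
            \<not> (\<exists>w. w \<noteq> u \<and> w \<noteq> v \<and> (u, w) \<in> zigzag n x \<and> (w, v) \<in> zigzag n x)}
         = zigzag_covers n x"
proof -
  have inj: "inj_on x {1..n}" using assms by (rule bij_betw_imp_inj_on)
  show ?thesis
    unfolding zigzag_eq[OF inj] using zigzag_covers_no_chain[OF inj] by blast
qed


subsection \<open>Order and Ehrhart polynomials are well defined\<close>

lemma rat_poly_eqI_positive:
  fixes p q :: "rat poly"
  assumes "\<And>t::nat. t > 0 \<Longrightarrow> poly p (of_nat t) = poly q (of_nat t)"
  shows "p = q"
proof (rule ccontr)
  assume "p \<noteq> q"
  then have "finite {z. poly (p - q) z = 0}" by (intro poly_roots_finite) simp
  moreover have "(of_nat :: nat \<Rightarrow> rat) ` {0<..} \<subseteq> {z. poly (p - q) z = 0}"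
    using assms by auto
  ultimately have "finite ((of_nat :: nat \<Rightarrow> rat) ` {0<..})" by (rule rev_finite_subset)
  then have "finite {0::nat<..}"
    by (rule finite_imageD) (simp add: inj_on_def)
  then show False by (simp add: infinite_Ioi)
qed

lemma ehrhart_polynomial_eqI:
  assumes "\<And>t::nat. t > 0 \<Longrightarrow>
    poly p (of_nat t) = of_nat (card ((\<lambda>v. real t *\<^sub>R v) ` P \<inter> integer_points))"
  shows "ehrhart_polynomial P = p"
  unfolding ehrhart_polynomial_def
  by (rule the_equality) (use assms in \<open>auto intro: rat_poly_eqI_positive\<close>)

lemma order_polynomial_eqI:
  assumes "\<And>t::nat. t > 0 \<Longrightarrow> poly p (of_nat t) = of_nat (card (order_preserving_maps r t))"
  shows "order_polynomial r = p"
  unfolding order_polynomial_def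
  by (rule the_equality) (use assms in \<open>auto intro: rat_poly_eqI_positive\<close>)

lemma card_order_preserving_with_range:
  fixes r :: "('a::finite) rel" and S :: "nat set"
  assumes "finite S"
  shows "card {f. range f = S \<and> (\<forall>(u, v) \<in> r. f u \<le> f v)}
       = card {f. range f = {..<card S} \<and> (\<forall>(u, v) \<in> r. f u \<le> (f v :: nat))}"
proof -
  obtain h where h: "bij_betw h {..<card S} S" "strict_mono_on {..<card S} h"
    using ex_bij_betw_strict_mono_card[OF assms] .
  have le: "h a \<le> h b \<longleftrightarrow> a \<le> b" if "a < card S" "b < card S" for a b
    using h(2) that
    by (metis lessThan_iff strict_mono_on_less_eq)
  let ?g = "inv_into {..<card S} h"
  have g: "?g y < card S" "h (?g y) = y" if "y \<in> S" for y
  proof -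
    have "y \<in> h ` {..<card S}" using that h(1) by (simp add: bij_betw_imp_surj_on)
    then show "?g y < card S" "h (?g y) = y"
      using inv_into_into[of y h "{..<card S}"] by (auto intro: f_inv_into_f)
  qed
  have "bij_betw (\<lambda>f. h \<circ> f) {f. range f = {..<card S} \<and> (\<forall>(u, v) \<in> r. f u \<le> f v)}
          {f. range f = S \<and> (\<forall>(u, v) \<in> r. f u \<le> f v)}"
  proof (rule bij_betw_byWitness[where f' = "\<lambda>f. ?g \<circ> f"])
    show "\<forall>f \<in> {f. range f = {..<card S} \<and> (\<forall>(u, v) \<in> r. f u \<le> f v)}. ?g \<circ> (h \<circ> f) = f"
    proof
      fix f assume "f \<in> {f. range f = {..<card S} \<and> (\<forall>(u, v) \<in> r. f u \<le> f v)}"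
      then have "f u \<in> {..<card S}" for u by blast
      then show "?g \<circ> (h \<circ> f) = f"
        using bij_betw_inv_into_left[OF h(1)] by (simp add: fun_eq_iff)
    qed
    show "\<forall>f \<in> {f. range f = S \<and> (\<forall>(u, v) \<in> r. f u \<le> f v)}. h \<circ> (?g \<circ> f) = f"
      using g(2) by (auto simp: fun_eq_iff)
    show "(\<lambda>f. h \<circ> f) ` {f. range f = {..<card S} \<and> (\<forall>(u, v) \<in> r. f u \<le> f v)}
          \<subseteq> {f. range f = S \<and> (\<forall>(u, v) \<in> r. f u \<le> f v)}"
    proof (rule image_subsetI)
      fix f :: "'a \<Rightarrow> nat"
      assume "f \<in> {f. range f = {..<card S} \<and> (\<forall>(u, v) \<in> r. f u \<le> f v)}"
      then have f: "range f = {..<card S}" "\<forall>(u, v) \<in> r. f u \<le> f v" by simp_all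
      have "f u < card S" for u using f(1) by auto
      moreover have "range (\<lambda>u. h (f u)) = S"
        using f(1) h(1) by (metis bij_betw_imp_surj_on image_image)
      ultimately show "h \<circ> f \<in> {f. range f = S \<and> (\<forall>(u, v) \<in> r. f u \<le> f v)}"
        using f(2) le by (auto simp: comp_def)
    qed
    show "(\<lambda>f. ?g \<circ> f) ` {f. range f = S \<and> (\<forall>(u, v) \<in> r. f u \<le> f v)}
          \<subseteq> {f. range f = {..<card S} \<and> (\<forall>(u, v) \<in> r. f u \<le> f v)}"
    proof (rule image_subsetI)
      fix f :: "'a \<Rightarrow> nat"
      assume "f \<in> {f. range f = S \<and> (\<forall>(u, v) \<in> r. f u \<le> f v)}"
      then have f: "range f = S" "\<forall>(u, v) \<in> r. f u \<le> f v" by simp_all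
      have fS: "f u \<in> S" for u using f(1) by auto
      have "range (\<lambda>u. ?g (f u)) = {..<card S}"
        using f(1) bij_betw_inv_into[OF h(1)] by (metis bij_betw_imp_surj_on image_image)
      moreover have "?g (f u) \<le> ?g (f v)" if "(u, v) \<in> r" for u v
        using le[OF g(1)[OF fS[of u]] g(1)[OF fS[of v]]] g(2)[OF fS] f(2) that by auto
      ultimately show "?g \<circ> f \<in> {f. range f = {..<card S} \<and> (\<forall>(u, v) \<in> r. f u \<le> f v)}"
        by (auto simp: comp_def)
    qed
  qed
  from bij_betw_same_card[OF this] show ?thesis by simp
qed

lemma card_order_preserving_maps:
  fixes r :: "('a::finite) rel"
  shows "card (order_preserving_maps r t) =
    (\<Sum>k\<le>CARD('a). (t choose k) *
       card {f. range f = {..<k} \<and> (\<forall>(u, v) \<in> r. f u \<le> (f v :: nat))})"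
proof -
  define e where "e k = card {f. range f = {..<k} \<and> (\<forall>(u, v) \<in> r. f u \<le> (f v :: nat))}" for k
  define G where "G S = {f. range f = S \<and> (\<forall>(u, v) \<in> r. f u \<le> (f v :: nat))}" for S
  have "order_preserving_maps r t = (\<Union>S \<in> Pow {1..t}. G S)"
    by (auto simp: order_preserving_maps_def G_def image_subset_iff)
  moreover have finG: "finite (G S)" if "finite S" for S
  proof (rule finite_subset)
    show "G S \<subseteq> Pi\<^sub>E UNIV (\<lambda>_. S)" by (auto simp: G_def)
    show "finite (Pi\<^sub>E (UNIV :: 'a set) (\<lambda>_. S))" using that by (intro finite_PiE) auto
  qed
  moreover have "card (\<Union>S \<in> Pow {1..t}. G S) = (\<Sum>S \<in> Pow {1..t}. card (G S))"
  proof (rule card_UN_disjoint)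
    show "\<forall>S\<in>Pow {1..t}. finite (G S)" using finG finite_subset by blast
    show "\<forall>S\<in>Pow {1..t}. \<forall>T\<in>Pow {1..t}. S \<noteq> T \<longrightarrow> G S \<inter> G T = {}"
      by (auto simp: G_def)
  qed simp
  ultimately have "card (order_preserving_maps r t) = (\<Sum>S \<in> Pow {1..t}. card (G S))" by simp
  also have "\<dots> = (\<Sum>S \<in> Pow {1..t}. e (card S))"
    unfolding G_def e_def
    by (intro sum.cong refl card_order_preserving_with_range) (auto intro: finite_subset)
  also have "\<dots> = (\<Sum>k\<le>t. (\<Sum>S \<in> {S \<in> Pow {1..t}. card S = k}. e (card S)))"
    by (rule sum.group[symmetric]) (auto simp: card_mono[of "{1..t}", simplified])
  also have "\<dots> = (\<Sum>k\<le>t. (t choose k) * e k)"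
  proof (rule sum.cong)
    fix k
    have "card {S \<in> Pow {1..t}. card S = k} = t choose k"
      using n_subsets[of "{1..t}" k] by simp
    then show "(\<Sum>S \<in> {S \<in> Pow {1..t}. card S = k}. e (card S)) = (t choose k) * e k" by simp
  qed simp
  also have "\<dots> = (\<Sum>k\<le>max t CARD('a). (t choose k) * e k)"
    by (rule sum.mono_neutral_left) auto
  also have "\<dots> = (\<Sum>k\<le>CARD('a). (t choose k) * e k)"
  proof (rule sum.mono_neutral_right)
    have "e k = 0" if "k > CARD('a)" for k
    proof -
      have "range f \<noteq> {..<k}" for f :: "'a \<Rightarrow> nat"
        using card_image_le[of UNIV f] that by auto
      then show ?thesis by (simp add: e_def)
    qed
    then show "\<forall>k\<in>{..max t CARD('a)} - {..CARD('a)}. (t choose k) * e k = 0" by simp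
  qed auto
  finally show ?thesis by (simp add: e_def)
qed

theorem poly_order_polynomial:
  fixes r :: "('a::finite) rel"
  shows "poly (order_polynomial r) (of_nat t) = of_nat (card (order_preserving_maps r t))"
proof -
  define b :: "nat \<Rightarrow> rat poly" where
    "b k = smult (1 / fact k) (\<Prod>i<k. [:- of_nat i, 1:])" for k
  have b: "poly (b k) (of_nat t) = of_nat (t choose k)" for k t
    by (simp add: b_def poly_prod binomial_gbinomial gbinomial_prod_rev atLeast0LessThan)
  define p where "p = (\<Sum>k\<le>CARD('a). smult (of_nat
       (card {f. range f = {..<k} \<and> (\<forall>(u, v) \<in> r. f u \<le> (f v :: nat))})) (b k))"
  have p: "poly p (of_nat t) = of_nat (card (order_preserving_maps r t))" for t
    by (simp add: p_def poly_sum b card_order_preserving_maps mult.commute)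
  then have "order_polynomial r = p" by (intro order_polynomial_eqI) simp
  then show ?thesis using p by simp
qed

lemma card_integer_points_order_polytope:
  fixes r :: "('a::finite) rel"
  assumes "t > 0"
  shows "card ((\<lambda>v. real t *\<^sub>R v) ` order_polytope r \<inter> integer_points)
       = card (order_preserving_maps r (t + 1))"
proof -
  have dil: "(\<lambda>v. real t *\<^sub>R v) ` order_polytope r =
     {f. (\<forall>u. 0 \<le> f $ u \<and> f $ u \<le> real t) \<and> (\<forall>(u, v) \<in> r. f $ u \<le> f $ v)}" (is "_ = ?D")
  proof
    show "(\<lambda>v. real t *\<^sub>R v) ` order_polytope r \<subseteq> ?D"
      using assms by (auto simp: order_polytope_def mult_left_le mult_left_mono)
    show "?D \<subseteq> (\<lambda>v. real t *\<^sub>R v) ` order_polytope r"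
    proof
      fix f assume "f \<in> ?D"
      then have "(1 / real t) *\<^sub>R f \<in> order_polytope r"
        using assms by (auto simp: order_polytope_def divide_simps)
      moreover have "f = real t *\<^sub>R ((1 / real t) *\<^sub>R f)" using assms by simp
      ultimately show "f \<in> (\<lambda>v. real t *\<^sub>R v) ` order_polytope r" by blast
    qed
  qed
  have "bij_betw (\<lambda>f. \<chi> u. real (f u) - 1) (order_preserving_maps r (t + 1)) (?D \<inter> integer_points)"
  proof (rule bij_betw_byWitness[where f' = "\<lambda>v u. nat \<lfloor>v $ u\<rfloor> + 1"])
    show "\<forall>f\<in>order_preserving_maps r (t + 1).
            (\<lambda>u. nat \<lfloor>(\<chi> u. real (f u) - 1) $ u\<rfloor> + 1) = f"
    proof
      fix f assume f: "f \<in> order_preserving_maps r (t + 1)"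
      have "nat \<lfloor>real (f u) - 1\<rfloor> + 1 = f u" for u
      proof -
        have "1 \<le> f u" using f by (auto simp: order_preserving_maps_def)
        then show ?thesis by linarith
      qed
      then show "(\<lambda>u. nat \<lfloor>(\<chi> u. real (f u) - 1) $ u\<rfloor> + 1) = f" by (simp add: fun_eq_iff)
    qed
    show "\<forall>v\<in>?D \<inter> integer_points. (\<chi> u. real (nat \<lfloor>v $ u\<rfloor> + 1) - 1) = v"
    proof
      fix v :: "real ^ 'a" assume v: "v \<in> ?D \<inter> integer_points"
      have "real (nat \<lfloor>v $ u\<rfloor>) = v $ u" for u
        using v by (auto simp: integer_points_def of_int_floor)
      then show "(\<chi> u. real (nat \<lfloor>v $ u\<rfloor> + 1) - 1) = v" by (simp add: vec_eq_iff)
    qed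
    show "(\<lambda>f. \<chi> u. real (f u) - 1) ` order_preserving_maps r (t + 1) \<subseteq> ?D \<inter> integer_points"
    proof clarify
      fix f assume f: "f \<in> order_preserving_maps r (t + 1)"
      have "1 \<le> f u \<and> f u \<le> t + 1" for u using f by (simp add: order_preserving_maps_def)
      then have "0 \<le> real (f u) - 1 \<and> real (f u) - 1 \<le> real t" for u
        by (metis add.commute diff_ge_0_iff_ge le_diff_eq of_nat_1 of_nat_add of_nat_le_iff diff_le_eq)
      moreover have "real (f u) \<le> real (f v)" if "(u, v) \<in> r" for u v
        using f that by (auto simp: order_preserving_maps_def)
      ultimately show "(\<chi> u. real (f u) - 1) \<in> ?D \<inter> integer_points"
        by (auto simp: integer_points_def)
    qed
    show "(\<lambda>v u. nat \<lfloor>v $ u\<rfloor> + 1) ` (?D \<inter> integer_points) \<subseteq> order_preserving_maps r (t + 1)"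
    proof clarify
      fix v :: "real ^ 'a"
      assume v: "\<forall>u. 0 \<le> v $ u \<and> v $ u \<le> real t" "\<forall>(u, w) \<in> r. v $ u \<le> v $ w"
      have "nat \<lfloor>v $ u\<rfloor> \<le> t" for u
        using v(1) by (metis floor_mono floor_of_nat nat_le_iff)
      moreover have "nat \<lfloor>v $ u\<rfloor> \<le> nat \<lfloor>v $ w\<rfloor>" if "(u, w) \<in> r" for u w
        using v(2) that by (intro nat_mono floor_mono) auto
      ultimately show "(\<lambda>u. nat \<lfloor>v $ u\<rfloor> + 1) \<in> order_preserving_maps r (t + 1)"
        by (auto simp: order_preserving_maps_def)
    qed
  qed
  from bij_betw_same_card[OF this] show ?thesis unfolding dil by simp
qed

theorem ehrhart_polynomial_order_polytope:
  "ehrhart_polynomial (order_polytope r) = pcompose (order_polynomial r) [:1, 1:]"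
proof (rule ehrhart_polynomial_eqI)
  fix t :: nat assume "t > 0"
  have "poly (pcompose (order_polynomial r) [:1, 1:]) (of_nat t)
      = poly (order_polynomial r) (of_nat (t + 1))"
    by (simp add: poly_pcompose)
  then show "poly (pcompose (order_polynomial r) [:1, 1:]) (of_nat t)
      = of_nat (card ((\<lambda>v. real t *\<^sub>R v) ` order_polytope r \<inter> integer_points))"
    using card_integer_points_order_polytope[OF \<open>t > 0\<close>, of r]
    by (simp only: poly_order_polynomial)
qed


subsection \<open>Order polytopes are lattice polytopes\<close>

lemma extreme_point_order_polytope:
  assumes "f extreme_point_of order_polytope r"
  shows "f $ u \<in> {0, 1}"
proof (rule ccontr)
  assume "f $ u \<notin> {0, 1}"
  have f: "\<And>w. 0 \<le> f $ w \<and> f $ w \<le> 1" "\<And>v w. (v, w) \<in> r \<Longrightarrow> f $ v \<le> f $ w"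
    using assms by (auto simp: extreme_point_of_def order_polytope_def)
  define c where "c = f $ u"
  have c: "0 < c" "c < 1" using f(1)[of u] \<open>f $ u \<notin> {0, 1}\<close> by (auto simp: c_def)
  define D where "D = {c, 1 - c} \<union> {\<bar>f $ w - c\<bar> | w. f $ w \<noteq> c}"
  define d where "d = Min D"
  have "finite D" by (simp add: D_def)
  have "D \<noteq> {}" by (simp add: D_def)
  have "d \<in> D" unfolding d_def using \<open>finite D\<close> \<open>D \<noteq> {}\<close> by (rule Min_in)
  then have "d > 0" using c by (auto simp: D_def)
  have dle: "d \<le> y" if "y \<in> D" for y
    unfolding d_def using \<open>finite D\<close> that by (rule Min_le)
  have dc: "d \<le> c" "d \<le> 1 - c" by (auto intro!: dle simp: D_def)
  have df: "d \<le> \<bar>f $ w - c\<bar>" if "f $ w \<noteq> c" for w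
    using that by (intro dle) (auto simp: D_def)
  define g where "g s = (\<chi> w. if f $ w = c then c + s else f $ w)" for s
  have g: "g s \<in> order_polytope r" if "\<bar>s\<bar> \<le> d" for s
  proof -
    have "0 \<le> g s $ w \<and> g s $ w \<le> 1" for w
      using that dc f(1)[of w] by (auto simp: g_def)
    moreover have "g s $ v \<le> g s $ w" if "(v, w) \<in> r" for v w
      using f(2)[OF that] df[of v] df[of w] \<open>\<bar>s\<bar> \<le> d\<close> by (auto simp: g_def)
    ultimately show ?thesis by (auto simp: order_polytope_def)
  qed
  have "f \<in> open_segment (g (- d)) (g d)"
    unfolding in_segment
  proof (intro conjI exI[of _ "1/2"])
    have "g (- d) $ u \<noteq> g d $ u" using \<open>d > 0\<close> by (simp add: g_def c_def)
    then show "g (- d) \<noteq> g d" by auto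
    show "f = (1 - 1/2) *\<^sub>R g (- d) + (1/2) *\<^sub>R g d"
      by (auto simp: vec_eq_iff g_def field_simps)
  qed auto
  moreover have "g (- d) \<in> order_polytope r" "g d \<in> order_polytope r"
    using \<open>d > 0\<close> by (auto intro: g)
  ultimately show False using assms by (auto simp: extreme_point_of_def)
qed

theorem lattice_polytope_order_polytope:
  fixes r :: "('a::finite) rel"
  shows "lattice_polytope (order_polytope r)"
proof -
  let ?P = "order_polytope r"
  let ?V = "{f. f extreme_point_of ?P}"
  have eq: "?P = (\<Inter>u. {f. 0 \<le> f $ u} \<inter> {f. f $ u \<le> 1}) \<inter> (\<Inter>(u, v) \<in> r. {f. f $ u \<le> f $ v})"
    by (auto simp: order_polytope_def)
  have "closed ?P"
    unfolding eq
    by (intro closed_Int closed_INT ballI)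
       (auto intro!: closed_Collect_le continuous_intros)
  moreover have "bounded ?P"
  proof (rule bounded_subset)
    show "?P \<subseteq> cbox 0 1" by (auto simp: order_polytope_def mem_box_cart)
  qed simp
  ultimately have "compact ?P" by (simp add: compact_eq_bounded_closed)
  moreover have "convex ?P"
  proof (rule convexI)
    fix f g :: "real ^ 'a" and a b :: real
    assume "f \<in> ?P" "g \<in> ?P" and ab: "0 \<le> a" "0 \<le> b" "a + b = 1"
    then have "0 \<le> a * f $ u + b * g $ u \<and> a * f $ u + b * g $ u \<le> 1" for u
      by (simp add: order_polytope_def convex_bound_le)
    moreover have "a * f $ u + b * g $ u \<le> a * f $ v + b * g $ v" if "(u, v) \<in> r" for u v
      using \<open>f \<in> ?P\<close> \<open>g \<in> ?P\<close> ab that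
      by (intro add_mono mult_left_mono) (auto simp: order_polytope_def)
    ultimately show "a *\<^sub>R f + b *\<^sub>R g \<in> ?P"
      by (auto simp: order_polytope_def)
  qed
  ultimately have "?P = convex hull ?V" by (rule Krein_Milman_Minkowski)
  moreover have "?V \<subseteq> integer_points"
  proof
    fix f assume "f \<in> ?V"
    then have "f $ u \<in> {0, 1}" for u by (intro extreme_point_order_polytope) simp
    then have "f $ u \<in> \<int>" for u
      by (metis Ints_0 Ints_1 empty_iff insert_iff)
    then show "f \<in> integer_points" by (simp add: integer_points_def)
  qed
  moreover have "finite ?V"
  proof (rule finite_subset)
    show "?V \<subseteq> vec_lambda ` (Pi\<^sub>E UNIV (\<lambda>_. {0, 1}))"
    proof
      fix f assume "f \<in> ?V"
      then have "f $ u \<in> {0, 1}" for u by (intro extreme_point_order_polytope) simp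
      then have "(\<lambda>u. f $ u) \<in> Pi\<^sub>E UNIV (\<lambda>_. {0, 1})" by (simp add: PiE_UNIV_domain)
      then have "vec_lambda (\<lambda>u. f $ u) \<in> vec_lambda ` (Pi\<^sub>E UNIV (\<lambda>_. {0, 1}))"
        by (rule imageI)
      then show "f \<in> vec_lambda ` (Pi\<^sub>E UNIV (\<lambda>_. {0, 1}))" by simp
    qed
    show "finite (vec_lambda ` (Pi\<^sub>E (UNIV :: 'a set) (\<lambda>_. {0, 1 :: real})))"
      by (intro finite_imageI finite_PiE) auto
  qed
  ultimately show ?thesis unfolding lattice_polytope_def by blast
qed

end

theory Submission
  imports Defs "HOL-Computational_Algebra.Formal_Power_Series"
begin

text \<open>
  Write \<open>\<Omega> n t\<close> for the number of order-preserving maps from the zig-zag poset on \<open>n\<close> elements to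
  \<open>{1..t}\<close>.  The reason for positivity is a closed form for the generating function over \<open>n\<close>.
  With \<open>\<psi> = arcsin (z / 2)\<close>,
    \<open>(\<Sum>n. \<Omega> n t * z ^ n) = (1 + Y) / (1 - Y)\<close>  where  \<open>Y = (1 + sin \<psi>) / cos \<psi> * tan (t * \<psi>)\<close>.
  Differentiating \<open>2 * sin \<psi> = z\<close> gives \<open>1 / cos \<psi> = 2 * \<psi>'\<close>, so the first factor of \<open>Y\<close> is
  \<open>(2 + z) * \<psi>'\<close>.  Both \<open>arcsin\<close> and \<open>tan\<close> have nonnegative Taylor coefficients.  Hence each
  coefficient of \<open>Y\<close> is a polynomial in \<open>t\<close> with nonnegative coefficients, and this property passes
  to \<open>(1 + Y) / (1 - Y) = 1 + 2 * (Y + Y ^ 2 + \<dots>)\<close>.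

  The closed form comes from solving a linear system (\<open>wave_packed_gf\<close>, \<open>packed_gf_eq\<close>).  Replacing
  the values at the maximal elements by \<open>t + 1\<close> minus the value turns the order-preserving maps into
  sequences over \<open>{1..t}\<close> in which adjacent entries add up to at most \<open>t + 1\<close>.  Let \<open>u i\<close> be the
  generating function of those sequences that may be preceded by \<open>i\<close>.  Splitting off the first entry
  gives \<open>u i = 1 + z * (\<Sum>j=1..t+1-i. u j)\<close>.  Successive differences make this the discrete wave
  equation \<open>u i - u (i + 1) = z * u (t + 1 - i)\<close>, which trigonometric functions of multiples of
  \<open>\<psi>\<close> solve, with boundary value \<open>u (t + 1) = 1\<close>.  The wanted series is \<open>u 1\<close>, because an entry
  preceded by \<open>1\<close> is unconstrained.

  The Ehrhart polynomial of the order polytope is the order polynomial at \<open>t + 1\<close>, and expanding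
  powers of \<open>t + 1\<close> preserves nonnegativity.
\<close>

unbundle no vec_syntax
unbundle fps_syntax

section \<open>The Taylor coefficients of the tangent\<close>

lemma fps_tan_times_cos: "fps_tan c * fps_cos c = fps_sin (c :: 'a :: field_char_0)"
  by (simp add: fps_tan_def fps_divide_unit mult.assoc inverse_mult_eq_1)

text \<open>
  Unlike the quotient form of the derivative, this equation determines each coefficient of the
  tangent from earlier ones, for \<open>c = 1\<close> with positive weights.
\<close>

lemma fps_tan_Riccati: "fps_deriv (fps_tan c) = fps_const c * (1 + (fps_tan (c::'a::field_char_0))\<^sup>2)"
proof -
  have unit: "(fps_cos c)\<^sup>2 $ 0 \<noteq> 0" by (simp add: power2_eq_square)
  have ne: "fps_cos c \<noteq> 0" by (metis fps_cos_nth_0 fps_zero_nth zero_neq_one)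
  have "fps_deriv (fps_tan c) * (fps_cos c)\<^sup>2 = fps_const c"
    using unit by (simp add: fps_tan_deriv fps_divide_unit mult.assoc inverse_mult_eq_1)
  also have "\<dots> = fps_const c * ((fps_cos c)\<^sup>2 + (fps_sin c)\<^sup>2)"
    by (simp add: fps_sin_cos_sum_of_squares)
  also have "\<dots> = (fps_const c * (1 + (fps_tan c)\<^sup>2)) * (fps_cos c)\<^sup>2"
    by (simp add: algebra_simps power_mult_distrib flip: fps_tan_times_cos)
  finally show ?thesis using ne by simp
qed

lemma fps_tan_nth_nonneg: "fps_tan (1::rat) $ n \<ge> 0"
proof (induction n rule: less_induct)
  case (less n)
  show ?case
  proof (cases n)
    case (Suc m)
    have "rat_of_nat (Suc m) * fps_tan 1 $ Suc m = (1 + (fps_tan 1)\<^sup>2) $ m"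
      using arg_cong[OF fps_tan_Riccati[of "1::rat"], of "\<lambda>f. f $ m"] by simp
    also have "\<dots> \<ge> 0"
      using less Suc by (auto simp: power2_eq_square fps_mult_nth intro!: add_nonneg_nonneg sum_nonneg)
    finally show ?thesis unfolding Suc by (simp add: zero_le_mult_iff)
  qed (simp add: fps_tan_def fps_divide_unit)
qed

lemma fps_tan_nth_scale: "fps_tan c $ n = c ^ n * fps_tan (1::'a::field_char_0) $ n"
proof -
  let ?l = "fps_const c * fps_X"
  have comp: "fps_sin c = fps_sin 1 oo ?l" "fps_cos c = fps_cos 1 oo ?l"
    by (auto simp: fps_eq_iff fps_sin_def fps_cos_def fps_compose_linear)
  have "(fps_tan 1 oo ?l) * fps_cos c = fps_tan c * fps_cos c"
    unfolding fps_tan_times_cos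
    unfolding comp by (simp add: fps_tan_times_cos flip: fps_compose_mult_distrib)
  moreover have "fps_cos c \<noteq> 0" by (metis fps_cos_nth_0 fps_zero_nth zero_neq_one)
  ultimately have "fps_tan c = fps_tan 1 oo ?l" by simp
  then show ?thesis by (simp add: fps_compose_linear)
qed

section \<open>The series of arcsin (z / 2) and trigonometric functions of its multiples\<close>

text \<open>
  The series \<open>\<psi> = arcsin (z / 2)\<close>, introduced as the compositional inverse of \<open>2 * sin\<close> so that
  \<open>2 * sin \<psi> = z\<close> holds by construction.
\<close>

definition arcsin_half :: "rat fps" where
  "arcsin_half = fps_inv (fps_const 2 * fps_sin 1)"

text \<open>
  The series \<open>sin (c * \<psi>)\<close> and \<open>cos (c * \<psi>)\<close>; the multiple \<open>c\<close> is rational because negative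
  multiples occur.
\<close>

definition sin_arc :: "rat \<Rightarrow> rat fps" where
  "sin_arc c = fps_sin c oo arcsin_half"

definition cos_arc :: "rat \<Rightarrow> rat fps" where
  "cos_arc c = fps_cos c oo arcsin_half"

lemma arcsin_half_nth_0 [simp]: "arcsin_half $ 0 = 0"
  by (simp add: arcsin_half_def fps_inv_def)

lemma fps_X_eq_sin_arc: "fps_X = 2 * sin_arc 1"
proof -
  have "fps_const 2 * sin_arc 1 = (fps_const 2 * fps_sin 1) oo arcsin_half"
    by (simp add: sin_arc_def fps_compose_mult_distrib)
  also have "\<dots> = fps_X"
    unfolding arcsin_half_def by (rule fps_inv_right) simp_all
  finally show ?thesis by (simp add: numeral_fps_const)
qed

lemma sin_cos_arc_add:
  "sin_arc (a + b) = sin_arc a * cos_arc b + cos_arc a * sin_arc b"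
  "cos_arc (a + b) = cos_arc a * cos_arc b - sin_arc a * sin_arc b"
  by (simp_all add: sin_arc_def cos_arc_def fps_sin_add fps_cos_add fps_compose_add_distrib
        fps_compose_sub_distrib fps_compose_mult_distrib)

lemma sin_cos_arc_minus:
  "sin_arc (- a) = - sin_arc a" "cos_arc (- a) = cos_arc a"
  by (simp_all add: sin_arc_def cos_arc_def fps_sin_even fps_cos_odd fps_compose_uminus)

lemma sin_cos_arc_squares: "cos_arc a * cos_arc a + sin_arc a * sin_arc a = 1"
  using arg_cong[OF fps_sin_cos_sum_of_squares[of a], of "\<lambda>f. f oo arcsin_half"]
  by (simp add: sin_arc_def cos_arc_def fps_compose_add_distrib fps_compose_mult_distrib
        power2_eq_square)

lemma cos_arc_nth_0 [simp]: "cos_arc a $ 0 = 1"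
  by (simp add: cos_arc_def)

lemma cos_arc_nonzero [simp]: "cos_arc a \<noteq> 0"
  by (metis cos_arc_nth_0 fps_zero_nth zero_neq_one)

text \<open>
  This is the derivative of \<open>2 * sin \<psi> = z\<close>.  It trades the factor \<open>1 / cos \<psi>\<close> for a
  multiple of \<open>\<psi>'\<close>, whose coefficients are accessible.
\<close>

lemma deriv_arcsin_half: "2 * cos_arc 1 * fps_deriv arcsin_half = 1"
proof -
  have "1 = 2 * fps_deriv (sin_arc 1)"
    using arg_cong[OF fps_X_eq_sin_arc, of fps_deriv] by simp
  also have "fps_deriv (sin_arc 1) = cos_arc 1 * fps_deriv arcsin_half"
    by (simp add: sin_arc_def cos_arc_def fps_compose_deriv fps_sin_deriv)
  finally show ?thesis by (simp add: mult.assoc)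
qed

text \<open>
  The equation \<open>(4 - z ^ 2) * \<psi>'' = z * \<psi>'\<close>, arranged with nonnegative terms only, so that it is a
  recurrence for the coefficients of \<open>\<psi>'\<close> with nonnegative weights.
\<close>

lemma deriv_arcsin_half_ode:
  fixes G defines "G \<equiv> fps_deriv arcsin_half"
  shows "4 * fps_deriv G = fps_X * G + fps_X * (fps_X * fps_deriv G)"
proof -
  let ?S = "sin_arc 1" and ?C = "cos_arc 1"
  have CG: "2 * ?C * G = 1" unfolding G_def by (rule deriv_arcsin_half)
  have dC: "fps_deriv ?C = - ?S * G"
    by (simp add: sin_arc_def cos_arc_def G_def fps_compose_deriv fps_cos_deriv fps_compose_uminus
        flip: fps_const_neg)
  have "fps_deriv (2 * ?C * G) = 0" unfolding CG by simp
  then have "?C * fps_deriv G = ?S * G * G" 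
    by (simp add: dC algebra_simps)
  then have "4 * (?C * ?C) * fps_deriv G = 2 * ?S * G * (2 * ?C * G)"
    by (simp add: algebra_simps)
  then have "4 * (?C * ?C) * fps_deriv G = 2 * ?S * G" unfolding CG by simp
  moreover have "?C * ?C = 1 - ?S * ?S" using sin_cos_arc_squares[of 1] by (simp add: algebra_simps)
  ultimately show ?thesis unfolding fps_X_eq_sin_arc by (simp add: algebra_simps)
qed

lemma deriv_arcsin_half_nth_nonneg: "fps_deriv arcsin_half $ n \<ge> 0"
proof (induction n rule: less_induct)
  case (less n)
  let ?G = "fps_deriv arcsin_half"
  show ?case
  proof (cases n)
    case 0
    have "2 * ?G $ 0 = 1"
      using arg_cong[OF deriv_arcsin_half, of "\<lambda>f. f $ 0"] by simp
    then show ?thesis using 0 by simp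
  next
    case (Suc m)
    have "4 * (rat_of_nat (Suc m) * ?G $ Suc m) = (4 * fps_deriv ?G) $ m"
      by (simp only: fps_deriv_nth numeral_fps_const fps_mult_left_const_nth) simp
    also have "\<dots> = (if m = 0 then 0 else ?G $ (m - 1) + of_nat (m - 1) * ?G $ (m - 1))"
      unfolding deriv_arcsin_half_ode
      by (cases m; cases "m - 1") (simp_all)
    also have "\<dots> \<ge> 0" using less[of "m - 1"] Suc by auto
    finally show ?thesis unfolding Suc by (simp add: zero_le_mult_iff)
  qed
qed

lemma arcsin_half_nth_nonneg: "arcsin_half $ n \<ge> 0"
proof (cases n)
  case (Suc m)
  have "0 \<le> rat_of_nat (Suc m) * arcsin_half $ Suc m"
    using deriv_arcsin_half_nth_nonneg[of m] by simp
  then show ?thesis unfolding Suc by (simp add: zero_le_mult_iff)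
qed simp


section \<open>Counting sequences with bounded adjacent sums\<close>

text \<open>
  The entry \<open>i\<close> in front is a constraint on the first element and is not counted in the length.
\<close>

definition packed_lists :: "nat \<Rightarrow> nat \<Rightarrow> nat \<Rightarrow> nat list set" where
  "packed_lists t i n =
     {hs. length hs = n \<and> set hs \<subseteq> {1..t} \<and> successively (\<lambda>a b. a + b \<le> t + 1) (i # hs)}"

lemma packed_lists_Suc:
  assumes "i \<ge> 1"
  shows "packed_lists t i (Suc n) = (\<Union>j\<in>{1..t + 1 - i}. Cons j ` packed_lists t j n)"
proof (rule set_eqI)
  fix hs
  show "hs \<in> packed_lists t i (Suc n) \<longleftrightarrow> hs \<in> (\<Union>j\<in>{1..t + 1 - i}. Cons j ` packed_lists t j n)"
    using assms by (cases hs) (auto simp: packed_lists_def)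
qed

lemma finite_packed_lists: "finite (packed_lists t i n)"
  by (rule finite_subset[OF _ finite_lists_length_eq[of "{1..t}" n]]) (auto simp: packed_lists_def)

lemma card_packed_lists_Suc:
  assumes "i \<ge> 1"
  shows "card (packed_lists t i (Suc n)) = (\<Sum>j=1..t + 1 - i. card (packed_lists t j n))"
  unfolding packed_lists_Suc[OF assms]
  by (subst card_UN_disjoint) (auto simp: finite_packed_lists card_image)

lemma packed_lists_0: "packed_lists t i 0 = {[]}"
  by (auto simp: packed_lists_def)

definition packed_gf :: "nat \<Rightarrow> nat \<Rightarrow> rat fps" where
  "packed_gf t i = Abs_fps (\<lambda>n. of_nat (card (packed_lists t i n)))"

lemma packed_gf_rec:
  assumes "i \<ge> 1"
  shows "packed_gf t i = 1 + fps_X * (\<Sum>j=1..t + 1 - i. packed_gf t j)"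
proof (rule fps_ext)
  fix n show "packed_gf t i $ n = (1 + fps_X * (\<Sum>j=1..t + 1 - i. packed_gf t j)) $ n"
    by (cases n) (simp_all add: packed_gf_def packed_lists_0 card_packed_lists_Suc[OF assms] fps_sum_nth)
qed

section \<open>The closed form of the generating function\<close>

text \<open>
  Up to a factor independent of \<open>a\<close>, this is \<open>cos (a * \<psi> + \<pi> / 4 - \<psi> / 2)\<close>, because
  \<open>tan (\<pi> / 4 - \<psi> / 2) = cos \<psi> / (1 + sin \<psi>)\<close>.  The phase is forced by \<open>wave_diff\<close>: the
  reversal \<open>i \<mapsto> t + 1 - i\<close> in the recurrence has to turn a sine into a cosine.
\<close>

definition wave :: "rat \<Rightarrow> rat fps" where
  "wave a = (1 + sin_arc 1) * cos_arc a - cos_arc 1 * sin_arc a"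

text \<open>
  At \<open>a = 2 * i - t - 1\<close>, stepping from \<open>i\<close> to \<open>i + 1\<close> adds \<open>2\<close> to \<open>a\<close>, and the reversal
  \<open>i \<mapsto> t + 1 - i\<close> negates \<open>a\<close>; so this is the difference form of \<open>packed_gf_rec\<close>.
\<close>

lemma wave_diff: "wave a - wave (a + 2) = fps_X * wave (- a)"
proof -
  define S C s c where "S = sin_arc 1" "C = cos_arc 1" "s = sin_arc a" "c = cos_arc a"
  have CC: "C * C = 1 - S * S"
    using sin_cos_arc_squares[of 1] by (simp add: S_C_s_c_def algebra_simps)
  have two: "sin_arc 2 = 2 * S * C" "cos_arc 2 = 1 - 2 * S * S"
    using sin_cos_arc_add[of 1 1] CC by (simp_all add: S_C_s_c_def[symmetric])
  have shift: "sin_arc (a + 2) = s * (1 - 2 * S * S) + c * (2 * S * C)"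
    "cos_arc (a + 2) = c * (1 - 2 * S * S) - s * (2 * S * C)"
    unfolding sin_cos_arc_add two S_C_s_c_def by simp_all
  have "wave a - wave (a + 2) - fps_X * wave (- a) =
      2 * S * c * (C * C - (1 - S * S))"
    unfolding wave_def shift sin_cos_arc_minus fps_X_eq_sin_arc
    by (simp add: S_C_s_c_def[symmetric] algebra_simps)
  then show ?thesis using CC by simp
qed

text \<open>
  Telescoping \<open>wave_diff\<close>, starting from the boundary index \<open>t + 1\<close>, recovers the summed form of
  the recurrence, with \<open>k = t + 1 - i\<close>.
\<close>

lemma wave_sum:
  "wave (of_nat t + 1 - 2 * of_nat k) =
     wave (of_nat t + 1) + fps_X * (\<Sum>j=1..k. wave (2 * of_nat j - of_nat t - 1))"
proof (induction k)
  case (Suc k)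
  define a :: rat where "a = of_nat t + 1 - 2 * of_nat (Suc k)"
  have "wave a = wave (of_nat t + 1 - 2 * of_nat k) + fps_X * wave (- a)"
    using wave_diff[of a] by (simp add: a_def algebra_simps)
  moreover have "- a = 2 * of_nat (Suc k) - of_nat t - 1" by (simp add: a_def)
  ultimately show ?case unfolding a_def[symmetric] Suc.IH by (simp add: algebra_simps)
qed simp

text \<open>
  Both sides satisfy the same linear recurrence with the same inhomogeneous term
  \<open>wave (t + 1)\<close>.  Their difference is \<open>z\<close> times a sum of such differences, so all its
  coefficients vanish by induction on their index.
\<close>

lemma wave_packed_gf:
  assumes "i \<in> {1..t + 1}"
  shows "wave (2 * of_nat i - of_nat t - 1) = wave (of_nat t + 1) * packed_gf t i"
proof -
  \<comment> \<open>The differences of the two sides, shown to vanish simultaneously for all \<open>i\<close>.\<close>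
  define D where "D i = wave (2 * of_nat i - of_nat t - 1) - wave (of_nat t + 1) * packed_gf t i" for i
  have D: "D i = fps_X * (\<Sum>j=1..t + 1 - i. D j)" if "i \<in> {1..t + 1}" for i
  proof -
    have "2 * of_nat i - of_nat t - 1 = of_nat t + 1 - 2 * (of_nat (t + 1 - i) :: rat)"
      using that by (simp add: of_nat_diff)
    then have "wave (2 * of_nat i - of_nat t - 1) =
      wave (of_nat t + 1) + fps_X * (\<Sum>j=1..t + 1 - i. wave (2 * of_nat j - of_nat t - 1))"
      by (simp only: wave_sum)
    moreover have "packed_gf t i = 1 + fps_X * (\<Sum>j=1..t + 1 - i. packed_gf t j)"
      using that by (intro packed_gf_rec) auto
    ultimately show ?thesis unfolding D_def[of i]
      by (simp add: D_def sum_subtractf sum_distrib_left algebra_simps)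
  qed
  have "D i $ n = 0" if "i \<in> {1..t + 1}" for n i using that
  proof (induction n arbitrary: i)
    case 0 then show ?case using D[of i] by simp
  next
    case (Suc n)
    have "D i $ Suc n = (\<Sum>j=1..t + 1 - i. D j $ n)"
      using D[OF Suc.prems] by (metis fps_X_mult_nth fps_sum_nth nat.distinct(1) diff_Suc_1)
    also have "\<dots> = 0" by (intro sum.neutral ballI Suc.IH) auto
    finally show ?case .
  qed
  then have "D i = 0" using assms by (simp add: fps_eq_iff)
  then show ?thesis by (simp add: D_def)
qed

text \<open>
  This is \<open>(1 + sin \<psi>) / cos \<psi> * tan (t * \<psi>)\<close>, written as a product of series with nonnegative
  coefficients.
\<close>

definition scaled_tan :: "nat \<Rightarrow> rat fps" where
  "scaled_tan t = (2 + fps_X) * fps_deriv arcsin_half * (fps_tan (of_nat t) oo arcsin_half)"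

text \<open>
  The solution is \<open>u 1 = wave (1 - t) / wave (t + 1)\<close>.  Writing \<open>S, C, s, c\<close> for the sines and cosines
  of \<open>\<psi>\<close> and \<open>t * \<psi>\<close>, the addition formulas give the numerator \<open>C * c + (1 + S) * s\<close> and the
  denominator \<open>C * c - (1 + S) * s\<close>; dividing both by \<open>C * c\<close> leaves \<open>(1 + Y) / (1 - Y)\<close>.
  Clearing the denominator yields the stated equation, which is a recurrence for the coefficients
  of \<open>u 1\<close> in which no minus sign occurs.
\<close>

lemma packed_gf_eq: "packed_gf t 1 = 1 + scaled_tan t + scaled_tan t * packed_gf t 1"
proof -
  define S C s c where "S = sin_arc 1" "C = cos_arc 1" "s = sin_arc (of_nat t)" "c = cos_arc (of_nat t)"
  note d = S_C_s_c_def
  let ?A = "packed_gf t 1" and ?Y = "scaled_tan t" and ?T = "fps_tan (of_nat t) oo arcsin_half"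
  have CC: "C * C = 1 - S * S"
    using sin_cos_arc_squares[of 1] by (simp add: d algebra_simps)
  \<comment> \<open>The last summand, a multiple of \<open>C ^ 2 + S ^ 2 - 1\<close>, makes this a polynomial identity.\<close>
  have "wave (of_nat t + 1) = C * c - (1 + S) * s - s * (C * C - (1 - S * S))"
    by (simp add: wave_def sin_cos_arc_add d[symmetric] algebra_simps)
  then have den: "wave (of_nat t + 1) = C * c - (1 + S) * s" by (simp add: CC)
  have "1 - of_nat t = - of_nat t + (1::rat)" by simp
  then have "wave (1 - of_nat t) = C * c + (1 + S) * s + s * (C * C - (1 - S * S))"
    by (simp only: wave_def sin_cos_arc_add sin_cos_arc_minus d[symmetric]) (simp add: algebra_simps)
  then have num: "wave (1 - of_nat t) = C * c + (1 + S) * s" by (simp add: CC)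
  have "wave (1 - of_nat t) = wave (of_nat t + 1) * ?A"
    using wave_packed_gf[of 1 t] by simp
  then have A: "C * c + (1 + S) * s = (C * c - (1 + S) * s) * ?A" unfolding num den .
  have Tc: "?T * c = s"
    by (simp add: d sin_arc_def cos_arc_def fps_tan_times_cos flip: fps_compose_mult_distrib)
  have "C * c * ?Y = (1 + S) * (2 * C * fps_deriv arcsin_half) * (?T * c)"
    unfolding scaled_tan_def fps_X_eq_sin_arc by (simp add: d[symmetric] algebra_simps)
  also have "\<dots> = (1 + S) * s"
    unfolding Tc using deriv_arcsin_half by (simp add: d)
  finally have Y: "(1 + S) * s = C * c * ?Y" ..
  have "C * c * ?A = C * c * (1 + ?Y + ?Y * ?A)"
    using A unfolding Y by (simp add: algebra_simps)
  then show ?thesis by (simp add: d)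
qed

section \<open>Polynomial dependence on the number of values\<close>

definition nonneg_polynomial :: "(nat \<Rightarrow> rat) \<Rightarrow> bool" where
  "nonneg_polynomial f \<longleftrightarrow> (\<exists>p. (\<forall>k. coeff p k \<ge> 0) \<and> (\<forall>t. f t = poly p (of_nat t)))"

lemma nonneg_polynomial_const: "c \<ge> 0 \<Longrightarrow> nonneg_polynomial (\<lambda>t. c)"
  unfolding nonneg_polynomial_def by (rule exI[of _ "[:c:]"]) (simp add: coeff_pCons split: nat.split)

lemma nonneg_polynomial_of_nat: "nonneg_polynomial of_nat"
  unfolding nonneg_polynomial_def by (rule exI[of _ "[:0, 1:]"]) (simp add: coeff_pCons split: nat.split)

lemma nonneg_polynomial_add:
  assumes "nonneg_polynomial f" "nonneg_polynomial g"
  shows "nonneg_polynomial (\<lambda>t. f t + g t)"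
proof -
  obtain p q where "\<And>k. coeff p k \<ge> 0" "\<And>t. f t = poly p (of_nat t)"
    "\<And>k. coeff q k \<ge> 0" "\<And>t. g t = poly q (of_nat t)"
    using assms unfolding nonneg_polynomial_def by metis
  then show ?thesis unfolding nonneg_polynomial_def by (intro exI[of _ "p + q"]) auto
qed

lemma nonneg_polynomial_mult:
  assumes "nonneg_polynomial f" "nonneg_polynomial g"
  shows "nonneg_polynomial (\<lambda>t. f t * g t)"
proof -
  obtain p q where "\<And>k. coeff p k \<ge> 0" "\<And>t. f t = poly p (of_nat t)"
    "\<And>k. coeff q k \<ge> 0" "\<And>t. g t = poly q (of_nat t)"
    using assms unfolding nonneg_polynomial_def by metis
  then show ?thesis unfolding nonneg_polynomial_def
    by (intro exI[of _ "p * q"]) (auto simp: coeff_mult intro!: sum_nonneg)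
qed

lemma nonneg_polynomial_power:
  "nonneg_polynomial f \<Longrightarrow> nonneg_polynomial (\<lambda>t. f t ^ k)"
  by (induction k) (auto intro: nonneg_polynomial_const nonneg_polynomial_mult)

lemma nonneg_polynomial_sum:
  "(\<And>i. i \<in> I \<Longrightarrow> nonneg_polynomial (f i)) \<Longrightarrow> nonneg_polynomial (\<lambda>t. \<Sum>i\<in>I. f i t)"
  by (induction I rule: infinite_finite_induct)
     (auto intro: nonneg_polynomial_const nonneg_polynomial_add)

lemma fps_mult_nth_nonneg:
  fixes f g :: "rat fps"
  assumes "\<And>n. f $ n \<ge> 0" "\<And>n. g $ n \<ge> 0"
  shows "(f * g) $ n \<ge> 0"
  using assms by (auto simp: fps_mult_nth intro!: sum_nonneg)

lemma fps_power_nth_nonneg: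
  fixes f :: "rat fps"
  assumes "\<And>n. f $ n \<ge> 0"
  shows "(f ^ k) $ n \<ge> 0"
proof (induction k arbitrary: n)
  case (Suc k)
  then show ?case using assms by (auto intro: fps_mult_nth_nonneg)
qed (simp)

text \<open>
  A coefficient of \<open>tan (t * \<psi>)\<close> is a finite combination of powers of \<open>t\<close>; its weights are
  coefficients of the tangent and of powers of \<open>\<psi>\<close>.
\<close>

lemma nonneg_polynomial_scaled_tan: "nonneg_polynomial (\<lambda>t. scaled_tan t $ n)"
proof -
  have tan: "nonneg_polynomial (\<lambda>t. (fps_tan (of_nat t) oo arcsin_half) $ m)" for m
    unfolding fps_compose_nth fps_tan_nth_scale[of "of_nat _"]
    by (intro nonneg_polynomial_sum nonneg_polynomial_mult nonneg_polynomial_power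
        nonneg_polynomial_of_nat nonneg_polynomial_const fps_tan_nth_nonneg
        fps_power_nth_nonneg arcsin_half_nth_nonneg)
  have "(2 + fps_X :: rat fps) $ m \<ge> 0" for m
    by (simp add: numeral_fps_const)
  then have "((2 + fps_X) * fps_deriv arcsin_half) $ m \<ge> 0" for m
    by (intro fps_mult_nth_nonneg deriv_arcsin_half_nth_nonneg)
  then show ?thesis unfolding scaled_tan_def fps_mult_nth[of "_ * _" "_ oo _"]
    by (intro nonneg_polynomial_sum nonneg_polynomial_mult nonneg_polynomial_const tan)
qed

lemma nonneg_polynomial_packed_gf: "nonneg_polynomial (\<lambda>t. packed_gf t 1 $ n)"
proof (induction n rule: less_induct)
  case (less n)
  let ?R = "\<lambda>t. \<Sum>i=1..n. scaled_tan t $ i * packed_gf t 1 $ (n - i)"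
  \<comment> \<open>The constant term of \<open>scaled_tan t\<close> is \<open>0\<close>, so only earlier coefficients occur on the right.\<close>
  have "packed_gf t 1 $ n = (if n = 0 then 1 else 0) + scaled_tan t $ n + ?R t" for t
  proof -
    have "scaled_tan t $ 0 = 0" by (simp add: scaled_tan_def fps_tan_def fps_divide_unit)
    then have "(scaled_tan t * packed_gf t 1) $ n = ?R t"
      by (simp add: fps_mult_nth sum.atLeast_Suc_atMost)
    then show ?thesis
      using arg_cong[OF packed_gf_eq[of t], of "\<lambda>f. f $ n"] by simp
  qed
  moreover have "nonneg_polynomial ?R"
    using less by (intro nonneg_polynomial_sum nonneg_polynomial_mult nonneg_polynomial_scaled_tan) auto
  ultimately show ?case
    by (simp only:) (intro nonneg_polynomial_add nonneg_polynomial_const nonneg_polynomial_scaled_tan; simp)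
qed

section \<open>Order-preserving maps of the zig-zag poset\<close>

lemma order_preserving_maps_zigzag_iff:
  assumes "bij_betw x {1..n} UNIV"
  shows "f \<in> order_preserving_maps (zigzag n x) t \<longleftrightarrow>
    (\<forall>j<n. f (x (Suc j)) \<in> {1..t}) \<and>
    (\<forall>j. Suc j < n \<longrightarrow> (if even j then f (x (Suc (Suc j))) \<le> f (x (Suc j))
                      else f (x (Suc j)) \<le> f (x (Suc (Suc j)))))"
proof -
  have range: "x ` Suc ` {..<n} = UNIV"
    using assms by (simp add: image_Suc_lessThan bij_betw_imp_surj_on)
  have "(\<forall>u. f u \<in> {1..t}) \<longleftrightarrow> (\<forall>u\<in>x ` Suc ` {..<n}. f u \<in> {1..t})"
    unfolding range by simp
  also have "\<dots> \<longleftrightarrow> (\<forall>j<n. f (x (Suc j)) \<in> {1..t})" by auto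
  finally have "(\<forall>u. f u \<in> {1..t}) \<longleftrightarrow> (\<forall>j<n. f (x (Suc j)) \<in> {1..t})" .
  moreover have "(\<forall>(u, v)\<in>zigzag n x. f u \<le> f v) \<longleftrightarrow> (\<forall>(u, v)\<in>zigzag_covers n x. f u \<le> f v)"
    using zigzag_eq[OF bij_betw_imp_inj_on[OF assms]] by auto
  moreover have "(\<forall>(u, v)\<in>zigzag_covers n x. f u \<le> f v) \<longleftrightarrow>
    (\<forall>i. 1 \<le> i \<and> i + 1 \<le> n \<longrightarrow> (if odd i then f (x (i + 1)) \<le> f (x i) else f (x i) \<le> f (x (i + 1))))"
    unfolding zigzag_covers_def by fastforce
  moreover have "\<dots> \<longleftrightarrow> (\<forall>j. Suc j < n \<longrightarrow> (if even j then f (x (Suc (Suc j))) \<le> f (x (Suc j))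
                      else f (x (Suc j)) \<le> f (x (Suc (Suc j)))))" (is "(\<forall>i. ?P i) \<longleftrightarrow> (\<forall>j. ?Q j)")
  proof
    assume P: "\<forall>i. ?P i"
    show "\<forall>j. ?Q j"
    proof
      fix j show "?Q j" using P[rule_format, of "Suc j"] by auto
    qed
  next
    assume Q: "\<forall>j. ?Q j"
    show "\<forall>i. ?P i"
    proof
      fix i show "?P i" using Q[rule_format, of "i - 1"] by (cases i) auto
    qed
  qed
  ultimately show ?thesis by (simp add: order_preserving_maps_def)
qed

text \<open>
  The constraint from a preceding \<open>1\<close> is vacuous for entries at most \<open>t\<close>.
\<close>

lemma packed_lists_iff:
  "hs \<in> packed_lists t 1 n \<longleftrightarrow> length hs = n \<and> (\<forall>j<n. hs ! j \<in> {1..t}) \<and>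
     (\<forall>j. Suc j < n \<longrightarrow> hs ! j + hs ! Suc j \<le> t + 1)"
proof -
  have "successively (\<lambda>a b. a + b \<le> t + 1) (1 # hs) \<longleftrightarrow> successively (\<lambda>a b. a + b \<le> t + 1) hs"
    if "set hs \<subseteq> {1..t}" using that by (cases hs) auto
  then have "hs \<in> packed_lists t 1 n \<longleftrightarrow>
      length hs = n \<and> set hs \<subseteq> {1..t} \<and> successively (\<lambda>a b. a + b \<le> t + 1) hs"
    unfolding packed_lists_def by blast
  then show ?thesis unfolding successively_conv_nth
    by (auto simp: set_conv_nth)
qed

text \<open>
  Reflecting the value \<open>a\<close> at a maximal element to \<open>t + 1 - a\<close> turns \<open>b \<le> a\<close> into
  \<open>(t + 1 - a) + b \<le> t + 1\<close>.  Lists are indexed from \<open>0\<close>, so the maximal elements, which have odd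
  index in the poset, sit at the even positions.
\<close>

lemma card_order_preserving_maps_zigzag:
  assumes bij: "bij_betw x {1..n} UNIV"
  shows "card (order_preserving_maps (zigzag n x) t) = card (packed_lists t 1 n)"
proof -
  define reflect where "reflect j a = (if even j then t + 1 - a else a)" for j a :: nat
  define enc where "enc f = map (\<lambda>j. reflect j (f (x (Suc j)))) [0..<n]" for f
  define idx where "idx u = inv_into {1..n} x u - 1" for u
  define dec where "dec hs u = reflect (idx u) (hs ! idx u)" for hs u
  have reflect: "reflect j (reflect j a) = a" "reflect j a \<in> {1..t}" if "a \<in> {1..t}" for j a
    using that by (auto simp: reflect_def)
  have idx_x: "idx (x (Suc j)) = j" if "j < n" for j
    using bij_betw_inv_into_left[OF bij, of "Suc j"] that by (simp add: idx_def)
  have x_idx: "x (Suc (idx u)) = u" "idx u < n" for u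
  proof -
    have "inv_into {1..n} x u \<in> {1..n}" "x (inv_into {1..n} x u) = u"
      using inv_into_into[of u x "{1..n}"] f_inv_into_f[of u x "{1..n}"] bij
      by (simp_all add: bij_betw_imp_surj_on)
    then show "x (Suc (idx u)) = u" "idx u < n" by (auto simp: idx_def)
  qed
  have "bij_betw enc (order_preserving_maps (zigzag n x) t) (packed_lists t 1 n)"
  proof (rule bij_betw_byWitness[where f' = dec])
    show "\<forall>f\<in>order_preserving_maps (zigzag n x) t. dec (enc f) = f"
      using reflect(1) by (auto simp: dec_def enc_def x_idx fun_eq_iff order_preserving_maps_def)
    show "\<forall>hs\<in>packed_lists t 1 n. enc (dec hs) = hs"
      using reflect(1)
      by (auto simp: dec_def enc_def idx_x packed_lists_iff[unfolded One_nat_def] intro!: nth_equalityI)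
    show "enc ` order_preserving_maps (zigzag n x) t \<subseteq> packed_lists t 1 n"
    proof clarify
      fix f assume "f \<in> order_preserving_maps (zigzag n x) t"
      then have f: "\<And>j. j < n \<Longrightarrow> f (x (Suc j)) \<in> {1..t}"
        "\<And>j. Suc j < n \<Longrightarrow> if even j then f (x (Suc (Suc j))) \<le> f (x (Suc j))
                      else f (x (Suc j)) \<le> f (x (Suc (Suc j)))"
        unfolding order_preserving_maps_zigzag_iff[OF bij] by auto
      have "enc f ! j + enc f ! Suc j \<le> t + 1" if "Suc j < n" for j
        using that f(2)[OF that] f(1)[of j] f(1)[of "Suc j"]
        by (auto simp: enc_def reflect_def split: if_splits)
      then show "enc f \<in> packed_lists t 1 n"
        unfolding packed_lists_iff using reflect(2) f(1) by (auto simp: enc_def)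
    qed
    show "dec ` packed_lists t 1 n \<subseteq> order_preserving_maps (zigzag n x) t"
    proof clarify
      fix hs assume "hs \<in> packed_lists t 1 n"
      then have h: "\<And>j. j < n \<Longrightarrow> hs ! j \<in> {1..t}"
        "\<And>j. Suc j < n \<Longrightarrow> hs ! j + hs ! Suc j \<le> t + 1"
        unfolding packed_lists_iff by auto
      have dec: "dec hs (x (Suc j)) = reflect j (hs ! j)" if "j < n" for j
        using that by (simp add: dec_def idx_x)
      have "if even j then dec hs (x (Suc (Suc j))) \<le> dec hs (x (Suc j))
                      else dec hs (x (Suc j)) \<le> dec hs (x (Suc (Suc j)))" if "Suc j < n" for j
        using that h(2)[OF that] h(1)[of j] h(1)[of "Suc j"] by (auto simp: dec reflect_def)
      moreover have "dec hs (x (Suc j)) \<in> {1..t}" if "j < n" for j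
        unfolding dec[OF that] by (rule reflect(2)[OF h(1)[OF that]])
      ultimately show "dec hs \<in> order_preserving_maps (zigzag n x) t"
        unfolding order_preserving_maps_zigzag_iff[OF bij] by blast
    qed
  qed
  then show ?thesis by (rule bij_betw_same_card)
qed

section \<open>Nonnegativity of the order and Ehrhart polynomials\<close>

lemma coeff_pcompose_nonneg:
  fixes p q :: "rat poly"
  assumes "\<And>k. coeff p k \<ge> 0" "\<And>k. coeff q k \<ge> 0"
  shows "coeff (pcompose p q) k \<ge> 0"
  using assms(1)
proof (induction p arbitrary: k)
  case (pCons a p)
  have "coeff p k \<ge> 0" for k using pCons.prems[of "Suc k"] by simp
  moreover have "a \<ge> 0" using pCons.prems[of 0] by simp
  moreover have "coeff (q * pcompose p q) k \<ge> 0"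
    unfolding coeff_mult using assms(2) pCons.IH[OF calculation(1)]
    by (intro sum_nonneg mult_nonneg_nonneg)
  moreover have "coeff [:a:] k \<ge> 0" using calculation(2) by (simp add: coeff_pCons split: nat.split)
  ultimately show ?case by (simp add: pcompose_pCons)
qed simp

theorem corollary5p2:
  fixes n :: nat and x :: "nat \<Rightarrow> 'a::finite"
  assumes "n \<ge> 2" and "bij_betw x {1..n} UNIV"
  shows "(\<forall>k. coeff (order_polynomial (zigzag n x)) k \<ge> 0) \<and>
         ehrhart_positive (order_polytope (zigzag n x))"
proof -
  obtain p :: "rat poly" where p: "\<And>k. coeff p k \<ge> 0"
    "\<And>t. packed_gf t 1 $ n = poly p (of_nat t)"
    using nonneg_polynomial_packed_gf unfolding nonneg_polynomial_def by metis
  have "order_polynomial (zigzag n x) = p"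
    by (rule order_polynomial_eqI)
       (simp add: card_order_preserving_maps_zigzag[OF assms(2)] packed_gf_def flip: p(2))
  then have nonneg: "\<forall>k. coeff (order_polynomial (zigzag n x)) k \<ge> 0" using p(1) by simp
  have "coeff [:1, 1 :: rat:] k \<ge> 0" for k by (simp add: coeff_pCons split: nat.split)
  then have "\<forall>k. coeff (ehrhart_polynomial (order_polytope (zigzag n x))) k \<ge> 0"
    unfolding ehrhart_polynomial_order_polytope using nonneg by (auto intro: coeff_pcompose_nonneg)
  then show ?thesis using nonneg lattice_polytope_order_polytope
    unfolding ehrhart_positive_def by blast
qed

end
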